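(* Let $(\mathcal C,\square,e,\alpha,\lambda,\rho,\tau)$ be an arbitrary symmetric monoidal category. Then every linear diagram made of $\lambda,\rho,\alpha$ and $\tau$ commutes in $\mathcal C$: for any objects of $\mathcal C$ substituted for the variables, any two paths of the diagram with the same source vertex and the same target vertex have equal composites in $\mathcal C$.
   Context: A monoidal category is a category $\mathcal C$ with a bifunctor $\square:\mathcal C\times\mathcal C\to\mathcal C$, an object $e$, and natural isomorphisms $\alpha_{xyz}:(x\square y)\square z\to x\square(y\square z)$, $\lambda_x:e\square x\to x$, $\rho_x:x\square e\to x$ such that the pentagonal identity $(\mathrm{id}\square\alpha_{yzt})\circ\alpha_{x,y\square z,t}\circ(\alpha_{xyz}\square\mathrm{id})=\alpha_{x,y,z\square t}\circ\alpha_{x\square y,z,t}$ and the triangular identity $(\mathrm{id}_x\square\lambda_y)\circ\alpha_{x,e,y}=\rho_x\square\mathrm{id}_y$ hold. A symmetric monoidal category is a monoidal category with a further natural isomorphism $\tau_{xy}:x\square y\to y\square x$ such that $\tau_{yx}\circ\tau_{xy}=\mathrm{id}$ and the hexagonal identity holds: $\alpha_{yzx}\circ\tau_{x,y\square z}\circ\alpha_{xyz}=(\mathrm{id}_y\square\tau_{xz})\circ\alpha_{yxz}\circ(\tau_{xy}\square\mathrm{id}_z)$. A diagram made of $\lambda,\rho,\alpha,\tau$ is a directed graph whose vertices are formal words built from variables and the constant $e$ with the binary operation $\square$, and whose edges are formal arrows between words obtained from components of $\lambda,\rho,\alpha,\tau$ (or, these being isomorphisms, their inverses) at words by applying $\square$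 with identities; substituting objects of $\mathcal C$ for the variables evaluates the diagram in $\mathcal C$. The diagram is linear if every variable appears at most once in each vertex. *)

theory Defs
  imports "Graph_Theory.Arc_Walk"
begin

section \<open>Categories\<close>

record ('o, 'a) category =
  Ob :: "'o set"
  Ar :: "'a set"
  Dom :: "'a \<Rightarrow> 'o"
  Cod :: "'a \<Rightarrow> 'o"
  Id :: "'o \<Rightarrow> 'a"
  Comp :: "'a \<Rightarrow> 'a \<Rightarrow> 'a"  (infixr "\<cdot>\<index>" 65)

text \<open>\<open>g \<cdot> f\<close> is "\<open>f\<close> first, then \<open>g\<close>"; its value matters only when the codomain of \<open>f\<close>
  is the domain of \<open>g\<close>.\<close>

definition Hom :: "('o, 'a, 'm) category_scheme \<Rightarrow> 'o \<Rightarrow> 'o \<Rightarrow> 'a set" where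
  "Hom C x y = {f \<in> Ar C. Dom C f = x \<and> Cod C f = y}"

locale category =
  fixes C :: "('o, 'a, 'm) category_scheme" (structure)
  assumes Dom_in_Ob: "f \<in> Ar C \<Longrightarrow> Dom C f \<in> Ob C"
    and Cod_in_Ob: "f \<in> Ar C \<Longrightarrow> Cod C f \<in> Ob C"
    and Id_in_Hom: "x \<in> Ob C \<Longrightarrow> Id C x \<in> Hom C x x"
    and Comp_in_Hom: "\<lbrakk>f \<in> Hom C x y; g \<in> Hom C y z\<rbrakk> \<Longrightarrow> g \<cdot> f \<in> Hom C x z"
    and Comp_Id: "f \<in> Hom C x y \<Longrightarrow> f \<cdot> Id C x = f"
    and Id_Comp: "f \<in> Hom C x y \<Longrightarrow> Id C y \<cdot> f = f"
    and Comp_assoc: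
      "\<lbrakk>f \<in> Hom C x y; g \<in> Hom C y z; h \<in> Hom C z w\<rbrakk> \<Longrightarrow> (h \<cdot> g) \<cdot> f = h \<cdot> (g \<cdot> f)"

definition inverse_arrows :: "('o, 'a, 'm) category_scheme \<Rightarrow> 'a \<Rightarrow> 'a \<Rightarrow> bool" where
  "inverse_arrows C f g \<longleftrightarrow> f \<in> Ar C \<and> g \<in> Hom C (Cod C f) (Dom C f) \<and>
     g \<cdot>\<^bsub>C\<^esub> f = Id C (Dom C f) \<and> f \<cdot>\<^bsub>C\<^esub> g = Id C (Cod C f)"

definition iso_arrow :: "('o, 'a, 'm) category_scheme \<Rightarrow> 'a \<Rightarrow> bool" where
  "iso_arrow C f \<longleftrightarrow> (\<exists>g. inverse_arrows C f g)"

definition inv_arrow :: "('o, 'a, 'm) category_scheme \<Rightarrow> 'a \<Rightarrow> 'a" where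
  "inv_arrow C f = (THE g. inverse_arrows C f g)"


section \<open>Symmetric monoidal categories\<close>

record ('o, 'a) monoidal_category = "('o, 'a) category" +
  BoxO :: "'o \<Rightarrow> 'o \<Rightarrow> 'o"  (infixl "\<box>\<index>" 70)
  BoxA :: "'a \<Rightarrow> 'a \<Rightarrow> 'a"  (infixl "\<boxtimes>\<index>" 70)
  UnitO :: "'o"  ("\<e>\<index>")
  Assoc :: "'o \<Rightarrow> 'o \<Rightarrow> 'o \<Rightarrow> 'a"
  LUnit :: "'o \<Rightarrow> 'a"
  RUnit :: "'o \<Rightarrow> 'a"

record ('o, 'a) symmetric_monoidal_category = "('o, 'a) monoidal_category" +
  Symm :: "'o \<Rightarrow> 'o \<Rightarrow> 'a"

text \<open>\<open>\<box>\<close> is the action of the bifunctor on objects, \<open>\<boxtimes>\<close> its action on arrows.\<close>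

locale monoidal_category = category C
  for C :: "('o, 'a, 'm) monoidal_category_scheme" (structure) +
  assumes BoxO_in_Ob: "\<lbrakk>x \<in> Ob C; y \<in> Ob C\<rbrakk> \<Longrightarrow> x \<box> y \<in> Ob C"
    and BoxA_in_Hom:
      "\<lbrakk>f \<in> Hom C x x'; g \<in> Hom C y y'\<rbrakk> \<Longrightarrow> f \<boxtimes> g \<in> Hom C (x \<box> y) (x' \<box> y')"
    and BoxA_Id: "\<lbrakk>x \<in> Ob C; y \<in> Ob C\<rbrakk> \<Longrightarrow> Id C x \<boxtimes> Id C y = Id C (x \<box> y)"
    and BoxA_Comp:
      "\<lbrakk>f \<in> Hom C x x'; f' \<in> Hom C x' x''; g \<in> Hom C y y'; g' \<in> Hom C y' y''\<rbrakk>
        \<Longrightarrow> (f' \<cdot> f) \<boxtimes> (g' \<cdot> g) = (f' \<boxtimes> g') \<cdot> (f \<boxtimes> g)"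
    and UnitO_in_Ob: "\<e> \<in> Ob C"
    and Assoc_in_Hom: "\<lbrakk>x \<in> Ob C; y \<in> Ob C; z \<in> Ob C\<rbrakk>
        \<Longrightarrow> Assoc C x y z \<in> Hom C ((x \<box> y) \<box> z) (x \<box> (y \<box> z))"
    and Assoc_iso: "\<lbrakk>x \<in> Ob C; y \<in> Ob C; z \<in> Ob C\<rbrakk> \<Longrightarrow> iso_arrow C (Assoc C x y z)"
    and Assoc_natural: "\<lbrakk>f \<in> Hom C x x'; g \<in> Hom C y y'; h \<in> Hom C z z'\<rbrakk>
        \<Longrightarrow> Assoc C x' y' z' \<cdot> ((f \<boxtimes> g) \<boxtimes> h) = (f \<boxtimes> (g \<boxtimes> h)) \<cdot> Assoc C x y z"
    and LUnit_in_Hom: "x \<in> Ob C \<Longrightarrow> LUnit C x \<in> Hom C (\<e> \<box> x) x"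
    and LUnit_iso: "x \<in> Ob C \<Longrightarrow> iso_arrow C (LUnit C x)"
    and LUnit_natural: "f \<in> Hom C x x' \<Longrightarrow> LUnit C x' \<cdot> (Id C \<e> \<boxtimes> f) = f \<cdot> LUnit C x"
    and RUnit_in_Hom: "x \<in> Ob C \<Longrightarrow> RUnit C x \<in> Hom C (x \<box> \<e>) x"
    and RUnit_iso: "x \<in> Ob C \<Longrightarrow> iso_arrow C (RUnit C x)"
    and RUnit_natural: "f \<in> Hom C x x' \<Longrightarrow> RUnit C x' \<cdot> (f \<boxtimes> Id C \<e>) = f \<cdot> RUnit C x"
    and pentagon: "\<lbrakk>x \<in> Ob C; y \<in> Ob C; z \<in> Ob C; t \<in> Ob C\<rbrakk>
        \<Longrightarrow> (Id C x \<boxtimes> Assoc C y z t) \<cdot> Assoc C x (y \<box> z) t \<cdot> (Assoc C x y z \<boxtimes> Id C t)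
          = Assoc C x y (z \<box> t) \<cdot> Assoc C (x \<box> y) z t"
    and triangle: "\<lbrakk>x \<in> Ob C; y \<in> Ob C\<rbrakk>
        \<Longrightarrow> (Id C x \<boxtimes> LUnit C y) \<cdot> Assoc C x \<e> y = RUnit C x \<boxtimes> Id C y"

locale symmetric_monoidal_category = monoidal_category C
  for C :: "('o, 'a, 'm) symmetric_monoidal_category_scheme" (structure) +
  assumes Symm_in_Hom:
      "\<lbrakk>x \<in> Ob C; y \<in> Ob C\<rbrakk> \<Longrightarrow> Symm C x y \<in> Hom C (x \<box> y) (y \<box> x)"
    and Symm_iso: "\<lbrakk>x \<in> Ob C; y \<in> Ob C\<rbrakk> \<Longrightarrow> iso_arrow C (Symm C x y)"
    and Symm_natural: "\<lbrakk>f \<in> Hom C x x'; g \<in> Hom C y y'\<rbrakk>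
        \<Longrightarrow> Symm C x' y' \<cdot> (f \<boxtimes> g) = (g \<boxtimes> f) \<cdot> Symm C x y"
    and Symm_Symm: "\<lbrakk>x \<in> Ob C; y \<in> Ob C\<rbrakk> \<Longrightarrow> Symm C y x \<cdot> Symm C x y = Id C (x \<box> y)"
    and hexagon: "\<lbrakk>x \<in> Ob C; y \<in> Ob C; z \<in> Ob C\<rbrakk>
        \<Longrightarrow> Assoc C y z x \<cdot> Symm C x (y \<box> z) \<cdot> Assoc C x y z
          = (Id C y \<boxtimes> Symm C x z) \<cdot> Assoc C y x z \<cdot> (Symm C x y \<boxtimes> Id C z)"


section \<open>Formal words and formal arrows\<close>

datatype 'v word = Var 'v | E | Box "'v word" "'v word"

datatype 'v component =
    Alpha "'v word" "'v word" "'v word"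
  | Lambda "'v word"
  | Rho "'v word"
  | Tau "'v word" "'v word"

text \<open>\<open>BoxId a w\<close> stands for \<open>a \<box> id\<^sub>w\<close>, and \<open>IdBox w a\<close> for \<open>id\<^sub>w \<box> a\<close>.\<close>

datatype 'v arrow =
    Fwd "'v component"
  | Inv "'v component"
  | BoxId "'v arrow" "'v word"
  | IdBox "'v word" "'v arrow"

fun comp_src :: "'v component \<Rightarrow> 'v word" where
  "comp_src (Alpha x y z) = Box (Box x y) z"
| "comp_src (Lambda x) = Box E x"
| "comp_src (Rho x) = Box x E"
| "comp_src (Tau x y) = Box x y"

fun comp_tgt :: "'v component \<Rightarrow> 'v word" where
  "comp_tgt (Alpha x y z) = Box x (Box y z)"
| "comp_tgt (Lambda x) = x"
| "comp_tgt (Rho x) = x"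
| "comp_tgt (Tau x y) = Box y x"

fun src :: "'v arrow \<Rightarrow> 'v word" where
  "src (Fwd c) = comp_src c"
| "src (Inv c) = comp_tgt c"
| "src (BoxId a w) = Box (src a) w"
| "src (IdBox w a) = Box w (src a)"

fun tgt :: "'v arrow \<Rightarrow> 'v word" where
  "tgt (Fwd c) = comp_tgt c"
| "tgt (Inv c) = comp_src c"
| "tgt (BoxId a w) = Box (tgt a) w"
| "tgt (IdBox w a) = Box w (tgt a)"

text \<open>The variables of a word from left to right, with repetitions.\<close>

fun word_vars :: "'v word \<Rightarrow> 'v list" where
  "word_vars (Var v) = [v]"
| "word_vars E = []"
| "word_vars (Box x y) = word_vars x @ word_vars y"


section \<open>Diagrams and their evaluation\<close>

definition diagram :: "('v word, 'v arrow) pre_digraph \<Rightarrow> bool" where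
  "diagram G \<longleftrightarrow> wf_digraph G \<and> (\<forall>a \<in> arcs G. tail G a = src a \<and> head G a = tgt a)"

definition linear_diagram :: "('v word, 'v arrow) pre_digraph \<Rightarrow> bool" where
  "linear_diagram G \<longleftrightarrow> diagram G \<and> (\<forall>w \<in> verts G. distinct (word_vars w))"

fun eval_word ::
  "('o, 'a, 'm) symmetric_monoidal_category_scheme \<Rightarrow> ('v \<Rightarrow> 'o) \<Rightarrow> 'v word \<Rightarrow> 'o" where
  "eval_word C s (Var v) = s v"
| "eval_word C s E = \<e>\<^bsub>C\<^esub>"
| "eval_word C s (Box x y) = eval_word C s x \<box>\<^bsub>C\<^esub> eval_word C s y"

fun eval_component ::
  "('o, 'a, 'm) symmetric_monoidal_category_scheme \<Rightarrow> ('v \<Rightarrow> 'o) \<Rightarrow> 'v component \<Rightarrow> 'a" where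
  "eval_component C s (Alpha x y z) =
     Assoc C (eval_word C s x) (eval_word C s y) (eval_word C s z)"
| "eval_component C s (Lambda x) = LUnit C (eval_word C s x)"
| "eval_component C s (Rho x) = RUnit C (eval_word C s x)"
| "eval_component C s (Tau x y) = Symm C (eval_word C s x) (eval_word C s y)"

fun eval_arrow ::
  "('o, 'a, 'm) symmetric_monoidal_category_scheme \<Rightarrow> ('v \<Rightarrow> 'o) \<Rightarrow> 'v arrow \<Rightarrow> 'a" where
  "eval_arrow C s (Fwd c) = eval_component C s c"
| "eval_arrow C s (Inv c) = inv_arrow C (eval_component C s c)"
| "eval_arrow C s (BoxId a w) = eval_arrow C s a \<boxtimes>\<^bsub>C\<^esub> Id C (eval_word C s w)"
| "eval_arrow C s (IdBox w a) = Id C (eval_word C s w) \<boxtimes>\<^bsub>C\<^esub> eval_arrow C s a"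

text \<open>The composite of a path starting at the word \<open>u\<close>; the empty path gives the identity.\<close>

fun eval_path ::
  "('o, 'a, 'm) symmetric_monoidal_category_scheme \<Rightarrow> ('v \<Rightarrow> 'o) \<Rightarrow> 'v word \<Rightarrow> 'v arrow list \<Rightarrow> 'a"
where
  "eval_path C s u [] = Id C (eval_word C s u)"
| "eval_path C s u (a # p) = eval_path C s (tgt a) p \<cdot>\<^bsub>C\<^esub> eval_arrow C s a"

end

theory Submission
  imports Defs
begin

text \<open>
  No coherence for permutations is needed, because variables can be moved out one at a time. If \<open>x\<close>
  occurs once in a word \<open>w\<close>, let \<open>w'\<close> be \<open>w\<close> with \<open>x\<close> replaced by \<open>e\<close>. There is an isomorphism
  \<open>w \<rightarrow> x \<box> w'\<close>, composed of associativities and of swaps \<open>a \<box> (x \<box> b) \<rightarrow> x \<box> (a \<box> b)\<close>, and it carries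
  every formal arrow \<open>f\<close> to \<open>id \<box> f'\<close>, where \<open>f'\<close> is \<open>f\<close> with the same replacement. Repeating this
  for all variables leaves words made of \<open>e\<close> only, whose collapse to \<open>e\<close> absorbs every formal arrow.
  Hence, for a fixed order of the variables, each word has an isomorphism to one common object that
  absorbs all formal arrows, so the composite of a path depends only on its ends.
\<close>

section \<open>Invertible arrows\<close>

context category
begin

lemma Hom_iff: "f \<in> Hom C x y \<longleftrightarrow> f \<in> Ar C \<and> Dom C f = x \<and> Cod C f = y"
  by (simp add: Hom_def)

lemma Dom_Cod_in_Ob [simp]:
  assumes "f \<in> Ar C"
  shows "Dom C f \<in> Ob C" "Cod C f \<in> Ob C"
  using assms by (simp_all add: Dom_in_Ob Cod_in_Ob)

lemma Id_typing [simp]: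
  assumes "x \<in> Ob C"
  shows "Id C x \<in> Ar C" "Dom C (Id C x) = x" "Cod C (Id C x) = x"
  using Id_in_Hom[OF assms] by (simp_all add: Hom_iff)

lemma Comp_typing [simp]:
  assumes "f \<in> Ar C" "g \<in> Ar C" "Dom C g = Cod C f"
  shows "g \<cdot> f \<in> Ar C" "Dom C (g \<cdot> f) = Dom C f" "Cod C (g \<cdot> f) = Cod C g"
  using Comp_in_Hom[of f "Dom C f" "Cod C f" g "Cod C g"] assms by (simp_all add: Hom_iff)

lemma Comp_Id_simp [simp]: "\<lbrakk>f \<in> Ar C; Dom C f = x\<rbrakk> \<Longrightarrow> f \<cdot> Id C x = f"
  using Comp_Id by (auto simp: Hom_iff)

lemma Id_Comp_simp [simp]: "\<lbrakk>f \<in> Ar C; Cod C f = x\<rbrakk> \<Longrightarrow> Id C x \<cdot> f = f"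
  using Id_Comp by (auto simp: Hom_iff)

lemma Comp_assoc_simp [simp]:
  "\<lbrakk>f \<in> Ar C; g \<in> Ar C; h \<in> Ar C; Dom C g = Cod C f; Dom C h = Cod C g\<rbrakk>
    \<Longrightarrow> (h \<cdot> g) \<cdot> f = h \<cdot> (g \<cdot> f)"
  using Comp_assoc by (simp add: Hom_iff)

text \<open>Simplification associates composites to the right, so a law for
  \<open>g \<cdot> f\<close> no longer matches once a factor \<open>r\<close> comes before
  \<open>f\<close>. This rule yields the \<open>_ext\<close> variants that do match.\<close>

lemma extend_right:
  "\<lbrakk>g \<cdot> f = e; f \<in> Ar C; g \<in> Ar C; r \<in> Ar C; Dom C g = Cod C f; Dom C f = Cod C r\<rbrakk>
    \<Longrightarrow> g \<cdot> (f \<cdot> r) = e \<cdot> r"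
  using Comp_assoc_simp by metis

lemma extend_right3:
  "\<lbrakk>h \<cdot> g \<cdot> f = e; f \<in> Ar C; g \<in> Ar C; h \<in> Ar C; r \<in> Ar C; Dom C g = Cod C f;
    Dom C h = Cod C g; Dom C f = Cod C r\<rbrakk> \<Longrightarrow> h \<cdot> (g \<cdot> (f \<cdot> r)) = e \<cdot> r"
  using extend_right[of h "g \<cdot> f" e r] by simp

section \<open>Uniqueness of inverses and cancellation\<close>

lemma inverse_arrows_unique:
  assumes "inverse_arrows C f g" "inverse_arrows C f h"
  shows "g = h"
proof -
  have "g = g \<cdot> (f \<cdot> h)"
    using assms by (simp add: inverse_arrows_def Hom_iff)
  also have "\<dots> = (g \<cdot> f) \<cdot> h"
    using assms by (subst Comp_assoc_simp) (simp_all add: inverse_arrows_def Hom_iff)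
  also have "\<dots> = h"
    using assms by (simp add: inverse_arrows_def Hom_iff)
  finally show ?thesis .
qed

lemma inverse_arrows_inv_arrow: "iso_arrow C f \<Longrightarrow> inverse_arrows C f (inv_arrow C f)"
  unfolding iso_arrow_def inv_arrow_def
  by (metis inverse_arrows_unique theI)

lemma iso_arrow_in_Ar: "iso_arrow C f \<Longrightarrow> f \<in> Ar C"
  by (auto simp: iso_arrow_def inverse_arrows_def)

lemma inv_arrow_simps [simp]:
  assumes "iso_arrow C f"
  shows "inv_arrow C f \<in> Ar C"
    "Dom C (inv_arrow C f) = Cod C f"
    "Cod C (inv_arrow C f) = Dom C f"
    "inv_arrow C f \<cdot> f = Id C (Dom C f)"
    "f \<cdot> inv_arrow C f = Id C (Cod C f)"
  using inverse_arrows_inv_arrow[OF assms] by (simp_all add: inverse_arrows_def Hom_iff)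

lemma inv_arrow_cancel [simp]:
  assumes "iso_arrow C f" "g \<in> Ar C"
  shows "Cod C g = Dom C f \<Longrightarrow> inv_arrow C f \<cdot> (f \<cdot> g) = g"
    "Cod C g = Cod C f \<Longrightarrow> f \<cdot> (inv_arrow C f \<cdot> g) = g"
  using assms iso_arrow_in_Ar[OF assms(1)]
    extend_right[OF inv_arrow_simps(4)[OF assms(1)]]
    extend_right[OF inv_arrow_simps(5)[OF assms(1)]]
  by simp_all

lemma iso_arrowI:
  "\<lbrakk>f \<in> Ar C; g \<in> Ar C; Dom C g = Cod C f; Cod C g = Dom C f;
    g \<cdot> f = Id C (Dom C f); f \<cdot> g = Id C (Cod C f)\<rbrakk> \<Longrightarrow> iso_arrow C f"
  by (auto simp: iso_arrow_def inverse_arrows_def Hom_iff)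

lemma iso_arrow_Id [simp]: "x \<in> Ob C \<Longrightarrow> iso_arrow C (Id C x)"
  by (rule iso_arrowI[of _ "Id C x"]) simp_all

lemma iso_arrow_inv_arrow [simp]: "iso_arrow C f \<Longrightarrow> iso_arrow C (inv_arrow C f)"
  by (rule iso_arrowI[of _ f]) (simp_all add: iso_arrow_in_Ar)

lemma iso_arrow_Comp [simp]:
  "\<lbrakk>iso_arrow C f; iso_arrow C g; Dom C g = Cod C f\<rbrakk> \<Longrightarrow> iso_arrow C (g \<cdot> f)"
  by (rule iso_arrowI[of _ "inv_arrow C f \<cdot> inv_arrow C g"]) (simp_all add: iso_arrow_in_Ar)

lemma iso_arrow_left_cancel:
  "\<lbrakk>f \<cdot> g = f \<cdot> h; iso_arrow C f; g \<in> Ar C; h \<in> Ar C; Cod C g = Dom C f; Cod C h = Dom C f\<rbrakk>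
    \<Longrightarrow> g = h"
  by (metis inv_arrow_cancel(1))

lemma iso_arrow_right_cancel:
  assumes "g \<cdot> f = h \<cdot> f" "iso_arrow C f" "g \<in> Ar C" "h \<in> Ar C"
    "Dom C g = Cod C f" "Dom C h = Cod C f"
  shows "g = h"
proof -
  have "(g \<cdot> f) \<cdot> inv_arrow C f = (h \<cdot> f) \<cdot> inv_arrow C f"
    using assms(1) by simp
  then show ?thesis
    using assms(2-) by (simp add: iso_arrow_in_Ar)
qed

text \<open>Carries naturality over to inverse components. The remaining domain and codomain
  equations are read off by applying \<open>Dom\<close> and \<open>Cod\<close> to the
  square.\<close>

lemma inv_arrow_square:
  assumes "g \<cdot> f = k \<cdot> h" "iso_arrow C f" "iso_arrow C k" "g \<in> Ar C" "h \<in> Ar C"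
    "Dom C g = Cod C f" "Dom C k = Cod C h"
  shows "h \<cdot> inv_arrow C f = inv_arrow C k \<cdot> g"
proof -
  have "Dom C h = Dom C f"
    using arg_cong[OF assms(1), of "Dom C"] assms(2-) by (simp add: iso_arrow_in_Ar)
  moreover have "inv_arrow C k \<cdot> ((g \<cdot> f) \<cdot> inv_arrow C f)
      = inv_arrow C k \<cdot> ((k \<cdot> h) \<cdot> inv_arrow C f)"
    using assms(1) by simp
  moreover have "Cod C g = Cod C k"
    using arg_cong[OF assms(1), of "Cod C"] assms(2-) by (simp add: iso_arrow_in_Ar)
  ultimately show ?thesis
    using assms(2-) by (simp add: iso_arrow_in_Ar)
qed

end


section \<open>Unit coherence\<close>

context monoidal_category
begin

lemmas Ob_simps [simp] = BoxO_in_Ob UnitO_in_Ob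

lemma BoxA_typing [simp]:
  assumes "f \<in> Ar C" "g \<in> Ar C"
  shows "f \<boxtimes> g \<in> Ar C" "Dom C (f \<boxtimes> g) = Dom C f \<box> Dom C g"
    "Cod C (f \<boxtimes> g) = Cod C f \<box> Cod C g"
  using BoxA_in_Hom[of f "Dom C f" "Cod C f" g "Dom C g" "Cod C g"] assms
  by (simp_all add: Hom_iff)

lemma Assoc_typing [simp]:
  assumes "x \<in> Ob C" "y \<in> Ob C" "z \<in> Ob C"
  shows "Assoc C x y z \<in> Ar C" "Dom C (Assoc C x y z) = (x \<box> y) \<box> z"
    "Cod C (Assoc C x y z) = x \<box> (y \<box> z)"
  using Assoc_in_Hom[OF assms] by (simp_all add: Hom_iff)

lemma LUnit_typing [simp]:
  assumes "x \<in> Ob C"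
  shows "LUnit C x \<in> Ar C" "Dom C (LUnit C x) = \<e> \<box> x" "Cod C (LUnit C x) = x"
  using LUnit_in_Hom[OF assms] by (simp_all add: Hom_iff)

lemma RUnit_typing [simp]:
  assumes "x \<in> Ob C"
  shows "RUnit C x \<in> Ar C" "Dom C (RUnit C x) = x \<box> \<e>" "Cod C (RUnit C x) = x"
  using RUnit_in_Hom[OF assms] by (simp_all add: Hom_iff)

lemmas iso_simps [simp] = Assoc_iso LUnit_iso RUnit_iso

declare BoxA_Id [simp]

section \<open>Interchange and naturality as rewrite rules\<close>

lemma interchange:
  "\<lbrakk>f \<in> Ar C; f' \<in> Ar C; g \<in> Ar C; g' \<in> Ar C; Dom C f' = Cod C f; Dom C g' = Cod C g\<rbrakk>
    \<Longrightarrow> (f' \<boxtimes> g') \<cdot> (f \<boxtimes> g) = (f' \<cdot> f) \<boxtimes> (g' \<cdot> g)"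
  using BoxA_Comp by (simp add: Hom_iff)

lemmas interchange_ext = extend_right[OF interchange]

lemma iso_arrow_BoxA [simp]: "\<lbrakk>iso_arrow C f; iso_arrow C g\<rbrakk> \<Longrightarrow> iso_arrow C (f \<boxtimes> g)"
  by (rule iso_arrowI[of _ "inv_arrow C f \<boxtimes> inv_arrow C g"])
    (simp_all add: iso_arrow_in_Ar interchange)

lemma inv_arrow_BoxA:
  assumes "iso_arrow C f" "iso_arrow C g"
  shows "inv_arrow C (f \<boxtimes> g) = inv_arrow C f \<boxtimes> inv_arrow C g"
  by (rule iso_arrow_left_cancel[of "f \<boxtimes> g"])
    (use assms in \<open>simp_all add: iso_arrow_in_Ar interchange\<close>)

lemma inv_arrow_Id [simp]: "x \<in> Ob C \<Longrightarrow> inv_arrow C (Id C x) = Id C x"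
  by (rule iso_arrow_left_cancel[of "Id C x"]) simp_all

lemma whisker_right:
  "\<lbrakk>f \<in> Ar C; g \<in> Ar C; Dom C g = Cod C f; x \<in> Ob C\<rbrakk>
    \<Longrightarrow> (g \<cdot> f) \<boxtimes> Id C x = (g \<boxtimes> Id C x) \<cdot> (f \<boxtimes> Id C x)"
  by (simp add: interchange)

lemma whisker_left:
  "\<lbrakk>f \<in> Ar C; g \<in> Ar C; Dom C g = Cod C f; x \<in> Ob C\<rbrakk>
    \<Longrightarrow> Id C x \<boxtimes> (g \<cdot> f) = (Id C x \<boxtimes> g) \<cdot> (Id C x \<boxtimes> f)"
  by (simp add: interchange)

lemma Assoc_nat:
  "\<lbrakk>f \<in> Ar C; g \<in> Ar C; h \<in> Ar C; Cod C f = x; Cod C g = y; Cod C h = z\<rbrakk>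
    \<Longrightarrow> Assoc C x y z \<cdot> ((f \<boxtimes> g) \<boxtimes> h)
      = (f \<boxtimes> (g \<boxtimes> h)) \<cdot> Assoc C (Dom C f) (Dom C g) (Dom C h)"
  using Assoc_natural by (auto simp: Hom_iff)

lemma LUnit_nat: "\<lbrakk>f \<in> Ar C; Cod C f = x\<rbrakk> \<Longrightarrow> LUnit C x \<cdot> (Id C \<e> \<boxtimes> f) = f \<cdot> LUnit C (Dom C f)"
  using LUnit_natural by (auto simp: Hom_iff)

lemma RUnit_nat: "\<lbrakk>f \<in> Ar C; Cod C f = x\<rbrakk> \<Longrightarrow> RUnit C x \<cdot> (f \<boxtimes> Id C \<e>) = f \<cdot> RUnit C (Dom C f)"
  using RUnit_natural by (auto simp: Hom_iff)

lemmas Assoc_nat_ext = extend_right[OF Assoc_nat]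
lemmas LUnit_nat_ext = extend_right[OF LUnit_nat]
lemmas triangle_ext = extend_right[OF triangle]
lemmas pentagon_ext = extend_right3[OF pentagon]

text \<open>Since the unit isomorphisms are natural, tensoring with \<open>\<e>\<close> is faithful.\<close>

lemma UnitO_left_faithful:
  assumes "Id C \<e> \<boxtimes> f = Id C \<e> \<boxtimes> g" "f \<in> Ar C" "g \<in> Ar C" "Dom C f = Dom C g" "Cod C f = Cod C g"
  shows "f = g"
proof (rule iso_arrow_right_cancel)
  show "f \<cdot> LUnit C (Dom C f) = g \<cdot> LUnit C (Dom C f)"
    using LUnit_nat[of f "Cod C f"] LUnit_nat[of g "Cod C f"] assms by simp
qed (use assms in simp_all)

lemma UnitO_right_faithful:
  assumes "f \<boxtimes> Id C \<e> = g \<boxtimes> Id C \<e>" "f \<in> Ar C" "g \<in> Ar C" "Dom C f = Dom C g" "Cod C f = Cod C g"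
  shows "f = g"
proof (rule iso_arrow_right_cancel)
  show "f \<cdot> RUnit C (Dom C f) = g \<cdot> RUnit C (Dom C f)"
    using RUnit_nat[of f "Cod C f"] RUnit_nat[of g "Cod C f"] assms by simp
qed (use assms in simp_all)

text \<open>Kelly's argument: after tensoring with \<open>\<e>\<close> and composing with the
  isomorphism \<open>?k\<close>, both sides are linked by the pentagon at
  \<open>\<e>, \<e>, x, y\<close> and two triangles. Faithfulness removes the extra
  \<open>\<e>\<close>.\<close>

lemma LUnit_BoxO:
  assumes [simp]: "x \<in> Ob C" "y \<in> Ob C"
  shows "LUnit C (x \<box> y) \<cdot> Assoc C \<e> x y = LUnit C x \<boxtimes> Id C y"
proof (rule UnitO_left_faithful)
  let ?k = "Assoc C \<e> (\<e> \<box> x) y \<cdot> (Assoc C \<e> \<e> x \<boxtimes> Id C y)"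
  show "Id C \<e> \<boxtimes> (LUnit C (x \<box> y) \<cdot> Assoc C \<e> x y) = Id C \<e> \<boxtimes> (LUnit C x \<boxtimes> Id C y)"
  proof (rule iso_arrow_right_cancel)
    have "(Id C \<e> \<boxtimes> (LUnit C (x \<box> y) \<cdot> Assoc C \<e> x y)) \<cdot> ?k
        = (Id C \<e> \<boxtimes> LUnit C (x \<box> y)) \<cdot> (Assoc C \<e> \<e> (x \<box> y) \<cdot> Assoc C (\<e> \<box> \<e>) x y)"
      by (simp add: whisker_left pentagon)
    also have "\<dots> = (RUnit C \<e> \<boxtimes> Id C (x \<box> y)) \<cdot> Assoc C (\<e> \<box> \<e>) x y"
      by (simp add: triangle_ext)
    also have "\<dots> = Assoc C \<e> x y \<cdot> ((RUnit C \<e> \<boxtimes> Id C x) \<boxtimes> Id C y)"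
      by (simp add: Assoc_nat)
    also have "\<dots> = Assoc C \<e> x y \<cdot> (((Id C \<e> \<boxtimes> LUnit C x) \<boxtimes> Id C y) \<cdot> (Assoc C \<e> \<e> x \<boxtimes> Id C y))"
      by (simp add: triangle flip: whisker_right)
    also have "\<dots> = (Id C \<e> \<boxtimes> (LUnit C x \<boxtimes> Id C y)) \<cdot> ?k"
      by (simp add: Assoc_nat_ext)
    finally show "(Id C \<e> \<boxtimes> (LUnit C (x \<box> y) \<cdot> Assoc C \<e> x y)) \<cdot> ?k
        = (Id C \<e> \<boxtimes> (LUnit C x \<boxtimes> Id C y)) \<cdot> ?k" .
  qed simp_all
qed simp_all

text \<open>The mirror image, from the pentagon at \<open>x, y, \<e>, \<e>\<close>; here an
  associativity is cancelled on the left.\<close>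

lemma RUnit_BoxO:
  assumes [simp]: "x \<in> Ob C" "y \<in> Ob C"
  shows "(Id C x \<boxtimes> RUnit C y) \<cdot> Assoc C x y \<e> = RUnit C (x \<box> y)"
proof (rule UnitO_right_faithful)
  show "((Id C x \<boxtimes> RUnit C y) \<cdot> Assoc C x y \<e>) \<boxtimes> Id C \<e> = RUnit C (x \<box> y) \<boxtimes> Id C \<e>"
  proof (rule iso_arrow_left_cancel)
    have "Assoc C x y \<e> \<cdot> (((Id C x \<boxtimes> RUnit C y) \<cdot> Assoc C x y \<e>) \<boxtimes> Id C \<e>)
        = (Id C x \<boxtimes> (RUnit C y \<boxtimes> Id C \<e>)) \<cdot> (Assoc C x (y \<box> \<e>) \<e> \<cdot> (Assoc C x y \<e> \<boxtimes> Id C \<e>))"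
      by (simp add: whisker_right Assoc_nat_ext)
    also have "\<dots> = (Id C x \<boxtimes> (Id C y \<boxtimes> LUnit C \<e>)) \<cdot> (Id C x \<boxtimes> Assoc C y \<e> \<e>) \<cdot>
        Assoc C x (y \<box> \<e>) \<e> \<cdot> (Assoc C x y \<e> \<boxtimes> Id C \<e>)"
      by (simp add: whisker_left flip: triangle)
    also have "\<dots> = (Id C x \<boxtimes> (Id C y \<boxtimes> LUnit C \<e>)) \<cdot> Assoc C x y (\<e> \<box> \<e>) \<cdot> Assoc C (x \<box> y) \<e> \<e>"
      by (simp add: pentagon)
    also have "\<dots> = Assoc C x y \<e> \<cdot> (Id C (x \<box> y) \<boxtimes> LUnit C \<e>) \<cdot> Assoc C (x \<box> y) \<e> \<e>"
      using Assoc_nat_ext[of "Id C x" "Id C y" "LUnit C \<e>" x y \<e>] by simp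
    also have "\<dots> = Assoc C x y \<e> \<cdot> (RUnit C (x \<box> y) \<boxtimes> Id C \<e>)"
      by (simp add: triangle)
    finally show "Assoc C x y \<e> \<cdot> (((Id C x \<boxtimes> RUnit C y) \<cdot> Assoc C x y \<e>) \<boxtimes> Id C \<e>)
        = Assoc C x y \<e> \<cdot> (RUnit C (x \<box> y) \<boxtimes> Id C \<e>)" .
  qed simp_all
qed simp_all

lemma LUnit_UnitO: "LUnit C \<e> = RUnit C \<e>"
proof (rule UnitO_right_faithful)
  \<comment> \<open>Naturality of \<open>LUnit\<close> along \<open>LUnit C \<e>\<close> itself,
    followed by cancelling the common left factor.\<close>
  have "LUnit C (\<e> \<box> \<e>) = Id C \<e> \<boxtimes> LUnit C \<e>"
    using LUnit_nat[of "LUnit C \<e>" \<e>] iso_arrow_left_cancel[of "LUnit C \<e>"] by simp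
  then show "LUnit C \<e> \<boxtimes> Id C \<e> = RUnit C \<e> \<boxtimes> Id C \<e>"
    using LUnit_BoxO[of \<e> \<e>] triangle[of \<e> \<e>] by simp
qed simp_all

end


section \<open>Symmetry\<close>

context symmetric_monoidal_category
begin

lemma Symm_typing [simp]:
  assumes "x \<in> Ob C" "y \<in> Ob C"
  shows "Symm C x y \<in> Ar C" "Dom C (Symm C x y) = x \<box> y" "Cod C (Symm C x y) = y \<box> x"
  using Symm_in_Hom[OF assms] by (simp_all add: Hom_iff)

declare Symm_iso [simp] Symm_Symm [simp]

lemma Symm_nat:
  "\<lbrakk>f \<in> Ar C; g \<in> Ar C; Cod C f = x; Cod C g = y\<rbrakk>
    \<Longrightarrow> Symm C x y \<cdot> (f \<boxtimes> g) = (g \<boxtimes> f) \<cdot> Symm C (Dom C f) (Dom C g)"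
  using Symm_natural by (auto simp: Hom_iff)

lemmas Symm_nat_ext = extend_right[OF Symm_nat]
lemmas Symm_Symm_ext = extend_right[OF Symm_Symm]
lemmas LUnit_BoxO_ext = extend_right[OF LUnit_BoxO]

text \<open>After tensoring with \<open>\<e>\<close> and composing with
  \<open>Symm C x \<e>\<close>, this is the hexagon at \<open>x, \<e>, \<e>\<close> with its units
  removed by \<open>LUnit_BoxO\<close> and the triangle.\<close>

lemma LUnit_Symm:
  assumes [simp]: "x \<in> Ob C"
  shows "LUnit C x \<cdot> Symm C x \<e> = RUnit C x"
proof (rule UnitO_right_faithful)
  show "(LUnit C x \<cdot> Symm C x \<e>) \<boxtimes> Id C \<e> = RUnit C x \<boxtimes> Id C \<e>"
  proof (rule iso_arrow_left_cancel)
    have "Symm C x \<e> \<cdot> ((LUnit C x \<cdot> Symm C x \<e>) \<boxtimes> Id C \<e>)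
       = Symm C x \<e> \<cdot> LUnit C (x \<box> \<e>) \<cdot> Assoc C \<e> x \<e> \<cdot> (Symm C x \<e> \<boxtimes> Id C \<e>)"
      by (simp add: whisker_right LUnit_BoxO_ext)
    also have "\<dots> = LUnit C (\<e> \<box> x) \<cdot> (Id C \<e> \<boxtimes> Symm C x \<e>) \<cdot> Assoc C \<e> x \<e> \<cdot> (Symm C x \<e> \<boxtimes> Id C \<e>)"
      by (simp add: LUnit_nat_ext)
    also have "\<dots> = LUnit C (\<e> \<box> x) \<cdot> Assoc C \<e> \<e> x \<cdot> Symm C x (\<e> \<box> \<e>) \<cdot> Assoc C x \<e> \<e>"
      by (simp add: hexagon)
    also have "\<dots> = (LUnit C \<e> \<boxtimes> Id C x) \<cdot> Symm C x (\<e> \<box> \<e>) \<cdot> Assoc C x \<e> \<e>"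
      by (simp add: LUnit_BoxO_ext)
    also have "\<dots> = Symm C x \<e> \<cdot> (Id C x \<boxtimes> LUnit C \<e>) \<cdot> Assoc C x \<e> \<e>"
      by (simp add: Symm_nat_ext)
    also have "\<dots> = Symm C x \<e> \<cdot> (RUnit C x \<boxtimes> Id C \<e>)"
      by (simp add: triangle)
    finally show "Symm C x \<e> \<cdot> ((LUnit C x \<cdot> Symm C x \<e>) \<boxtimes> Id C \<e>)
        = Symm C x \<e> \<cdot> (RUnit C x \<boxtimes> Id C \<e>)" .
  qed simp_all
qed simp_all

lemma RUnit_Symm:
  assumes [simp]: "x \<in> Ob C"
  shows "RUnit C x \<cdot> Symm C \<e> x = LUnit C x"
  by (simp flip: LUnit_Symm)


subsection \<open>Swapping the first two of three factors\<close>

definition swap :: "'o \<Rightarrow> 'o \<Rightarrow> 'o \<Rightarrow> 'a" where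
  "swap x y z = Assoc C y x z \<cdot> (Symm C x y \<boxtimes> Id C z) \<cdot> inv_arrow C (Assoc C x y z)"

lemma swap_typing [simp]:
  assumes "x \<in> Ob C" "y \<in> Ob C" "z \<in> Ob C"
  shows "swap x y z \<in> Ar C" "Dom C (swap x y z) = x \<box> (y \<box> z)"
    "Cod C (swap x y z) = y \<box> (x \<box> z)" "iso_arrow C (swap x y z)"
  using assms by (simp_all add: swap_def)

text \<open>Composing with \<open>Assoc\<close> hides the inverse in \<open>swap\<close>, which is
  why several identities below are checked after such a composition.\<close>

lemma swap_Assoc:
  "\<lbrakk>x \<in> Ob C; y \<in> Ob C; z \<in> Ob C\<rbrakk>
    \<Longrightarrow> swap x y z \<cdot> Assoc C x y z = Assoc C y x z \<cdot> (Symm C x y \<boxtimes> Id C z)"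
  by (simp add: swap_def)

lemmas swap_Assoc_ext = extend_right[OF swap_Assoc]

section \<open>Identities for swaps\<close>

lemma swap_swap:
  assumes [simp]: "x \<in> Ob C" "y \<in> Ob C" "z \<in> Ob C"
  shows "swap y x z \<cdot> swap x y z = Id C (x \<box> (y \<box> z))"
  by (rule iso_arrow_right_cancel[of _ "Assoc C x y z"])
    (simp_all add: swap_Assoc swap_Assoc_ext flip: whisker_right)

lemma swap_nat:
  assumes [simp]: "f \<in> Ar C" "g \<in> Ar C" "h \<in> Ar C"
    and cod: "Cod C f = x" "Cod C g = y" "Cod C h = z"
  shows "swap x y z \<cdot> (f \<boxtimes> (g \<boxtimes> h))
      = (g \<boxtimes> (f \<boxtimes> h)) \<cdot> swap (Dom C f) (Dom C g) (Dom C h)"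
  unfolding cod[symmetric]
proof (rule iso_arrow_right_cancel)
  let ?a = "Assoc C (Dom C f) (Dom C g) (Dom C h)"
  let ?s = "swap (Cod C f) (Cod C g) (Cod C h)"
  have "(?s \<cdot> (f \<boxtimes> (g \<boxtimes> h))) \<cdot> ?a
      = ?s \<cdot> Assoc C (Cod C f) (Cod C g) (Cod C h) \<cdot> ((f \<boxtimes> g) \<boxtimes> h)"
    by (simp add: Assoc_nat)
  also have "\<dots> = Assoc C (Cod C g) (Cod C f) (Cod C h) \<cdot> ((g \<boxtimes> f) \<boxtimes> h)
      \<cdot> (Symm C (Dom C f) (Dom C g) \<boxtimes> Id C (Dom C h))"
    by (simp add: swap_Assoc_ext interchange Symm_nat)
  also have "\<dots> = ((g \<boxtimes> (f \<boxtimes> h)) \<cdot> swap (Dom C f) (Dom C g) (Dom C h)) \<cdot> ?a"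
    by (simp add: swap_Assoc Assoc_nat_ext)
  finally show "(?s \<cdot> (f \<boxtimes> (g \<boxtimes> h))) \<cdot> ?a
      = ((g \<boxtimes> (f \<boxtimes> h)) \<cdot> swap (Dom C f) (Dom C g) (Dom C h)) \<cdot> ?a" .
qed simp_all

text \<open>The second hexagon, for moving \<open>z\<close> past \<open>y\<close> and then past
  \<open>x\<close>; it follows from the first by inverting symmetries.\<close>

lemma Symm_BoxO_left:
  assumes [simp]: "x \<in> Ob C" "y \<in> Ob C" "z \<in> Ob C"
  shows "swap x z y \<cdot> (Id C x \<boxtimes> Symm C y z) \<cdot> Assoc C x y z = Symm C (x \<box> y) z"
proof (rule iso_arrow_right_cancel)
  \<comment> \<open>With this composite the hexagon at \<open>z, x, y\<close> applies on the left,
    while two symmetries cancel on the right.\<close>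
  let ?k = "Symm C z (x \<box> y) \<cdot> Assoc C z x y"
  have "(swap x z y \<cdot> (Id C x \<boxtimes> Symm C y z) \<cdot> Assoc C x y z) \<cdot> ?k
      = swap x z y \<cdot> (Id C x \<boxtimes> Symm C y z) \<cdot> (Id C x \<boxtimes> Symm C z y) \<cdot> Assoc C x z y
        \<cdot> (Symm C z x \<boxtimes> Id C y)"
    by (simp add: hexagon)
  also have "\<dots> = swap x z y \<cdot> Assoc C x z y \<cdot> (Symm C z x \<boxtimes> Id C y)"
    by (simp add: interchange_ext)
  also have "\<dots> = Assoc C z x y"
    by (simp add: swap_Assoc_ext interchange)
  also have "\<dots> = Symm C (x \<box> y) z \<cdot> ?k"
    by (simp add: Symm_Symm_ext)
  finally show "(swap x z y \<cdot> (Id C x \<boxtimes> Symm C y z) \<cdot> Assoc C x y z) \<cdot> ?k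
      = Symm C (x \<box> y) z \<cdot> ?k" .
qed simp_all

lemma swap_Symm:
  assumes [simp]: "x \<in> Ob C" "y \<in> Ob C" "z \<in> Ob C"
  shows "swap z x y \<cdot> Symm C (x \<box> y) z = (Id C x \<boxtimes> Symm C y z) \<cdot> Assoc C x y z"
  by (simp add: extend_right[OF swap_swap] flip: Symm_BoxO_left)

text \<open>Treats an associativity whose middle factor starts with \<open>x\<close>. The pentagons
  at \<open>x, a, b, c\<close> and \<open>a, x, b, c\<close> are glued along naturality of
  \<open>Assoc\<close> for the symmetry.\<close>

lemma swap_BoxO_right:
  assumes [simp]: "a \<in> Ob C" "x \<in> Ob C" "b \<in> Ob C" "c \<in> Ob C"
  shows "(Id C x \<boxtimes> Assoc C a b c) \<cdot> Assoc C x (a \<box> b) c \<cdot> (swap a x b \<boxtimes> Id C c)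
    = swap a x (b \<box> c) \<cdot> (Id C a \<boxtimes> Assoc C x b c) \<cdot> Assoc C a (x \<box> b) c"
    (is "?l = ?r")
proof (rule iso_arrow_right_cancel)
  let ?k = "Assoc C a x b \<boxtimes> Id C c"
  have "?l \<cdot> ?k = (Id C x \<boxtimes> Assoc C a b c) \<cdot> Assoc C x (a \<box> b) c \<cdot> (Assoc C x a b \<boxtimes> Id C c)
      \<cdot> ((Symm C a x \<boxtimes> Id C b) \<boxtimes> Id C c)"
    by (simp add: swap_Assoc flip: whisker_right)
  also have "\<dots> = Assoc C x a (b \<box> c) \<cdot> (Symm C a x \<boxtimes> Id C (b \<box> c)) \<cdot> Assoc C (a \<box> x) b c"
    by (simp add: pentagon_ext Assoc_nat)
  also have "\<dots> = swap a x (b \<box> c) \<cdot> Assoc C a x (b \<box> c) \<cdot> Assoc C (a \<box> x) b c"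
    by (simp add: swap_Assoc_ext)
  also have "\<dots> = ?r \<cdot> ?k"
    by (simp add: pentagon)
  finally show "?l \<cdot> ?k = ?r \<cdot> ?k" .
qed simp_all

text \<open>Treats an associativity whose third factor starts with \<open>x\<close>: passing
  \<open>a \<box> b\<close> at once agrees with passing \<open>b\<close>, then \<open>a\<close>. The
  second hexagon reduces it to \<open>swap_BoxO_right\<close>.\<close>

lemma swap_BoxO_left:
  assumes [simp]: "a \<in> Ob C" "b \<in> Ob C" "x \<in> Ob C" "c \<in> Ob C"
  shows "(Id C x \<boxtimes> Assoc C a b c) \<cdot> swap (a \<box> b) x c
    = swap a x (b \<box> c) \<cdot> (Id C a \<boxtimes> swap b x c) \<cdot> Assoc C a b (x \<box> c)"
    (is "?l = ?r")
proof (rule iso_arrow_right_cancel)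
  let ?k = "Assoc C (a \<box> b) x c"
  have "?l \<cdot> ?k = (Id C x \<boxtimes> Assoc C a b c) \<cdot> Assoc C x (a \<box> b) c \<cdot> (swap a x b \<boxtimes> Id C c)
      \<cdot> ((Id C a \<boxtimes> Symm C b x) \<boxtimes> Id C c) \<cdot> (Assoc C a b x \<boxtimes> Id C c)"
    by (simp add: swap_Assoc Symm_BoxO_left flip: whisker_right)
  also have "\<dots> = swap a x (b \<box> c) \<cdot> (Id C a \<boxtimes> Assoc C x b c) \<cdot> Assoc C a (x \<box> b) c
      \<cdot> ((Id C a \<boxtimes> Symm C b x) \<boxtimes> Id C c) \<cdot> (Assoc C a b x \<boxtimes> Id C c)"
    by (simp add: extend_right3[OF swap_BoxO_right])
  also have "\<dots> = swap a x (b \<box> c) \<cdot> (Id C a \<boxtimes> (Assoc C x b c \<cdot> (Symm C b x \<boxtimes> Id C c)))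
      \<cdot> Assoc C a (b \<box> x) c \<cdot> (Assoc C a b x \<boxtimes> Id C c)"
    by (simp add: Assoc_nat_ext whisker_left)
  also have "\<dots> = swap a x (b \<box> c) \<cdot> (Id C a \<boxtimes> swap b x c) \<cdot> (Id C a \<boxtimes> Assoc C b x c)
      \<cdot> Assoc C a (b \<box> x) c \<cdot> (Assoc C a b x \<boxtimes> Id C c)"
    by (simp add: whisker_left flip: swap_Assoc)
  also have "\<dots> = ?r \<cdot> ?k"
    by (simp add: pentagon)
  finally show "?l \<cdot> ?k = ?r \<cdot> ?k" .
qed simp_all

lemma LUnit_swap:
  assumes [simp]: "x \<in> Ob C" "y \<in> Ob C"
  shows "(Id C x \<boxtimes> LUnit C y) \<cdot> swap \<e> x y = LUnit C (x \<box> y)" (is "?l = ?r")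
proof (rule iso_arrow_right_cancel)
  show "?l \<cdot> Assoc C \<e> x y = ?r \<cdot> Assoc C \<e> x y"
    by (simp add: swap_Assoc triangle_ext LUnit_BoxO RUnit_Symm flip: whisker_right)
qed simp_all

lemma Symm_swap:
  assumes [simp]: "x \<in> Ob C" "y \<in> Ob C" "z \<in> Ob C"
  shows "(Id C x \<boxtimes> Symm C z y) \<cdot> swap z x y = Assoc C x y z \<cdot> Symm C z (x \<box> y)"
proof (rule iso_arrow_right_cancel)
  show "((Id C x \<boxtimes> Symm C z y) \<cdot> swap z x y) \<cdot> Symm C (x \<box> y) z
      = (Assoc C x y z \<cdot> Symm C z (x \<box> y)) \<cdot> Symm C (x \<box> y) z"
    by (simp add: swap_Symm interchange_ext)
qed simp_all

text \<open>\<open>BoxA_Id\<close> merges the two identities into one, after which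
  \<open>Assoc_nat\<close> does not match; hence this instance in merged form.\<close>

lemma Assoc_nat_right:
  "\<lbrakk>x \<in> Ob C; y \<in> Ob C; f \<in> Ar C; Cod C f = z\<rbrakk>
    \<Longrightarrow> Assoc C x y z \<cdot> (Id C (x \<box> y) \<boxtimes> f)
      = (Id C x \<boxtimes> (Id C y \<boxtimes> f)) \<cdot> Assoc C x y (Dom C f)"
  using Assoc_nat[of "Id C x" "Id C y" f x y z] by simp

lemma swap_nat_left:
  "\<lbrakk>y \<in> Ob C; z \<in> Ob C; f \<in> Ar C; Cod C f = x\<rbrakk>
    \<Longrightarrow> swap x y z \<cdot> (f \<boxtimes> Id C (y \<box> z))
      = (Id C y \<boxtimes> (f \<boxtimes> Id C z)) \<cdot> swap (Dom C f) y z"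
  using swap_nat[of f "Id C y" "Id C z" x y z] by simp

lemmas swap_nat_ext = extend_right[OF swap_nat]
lemmas swap_nat_left_ext = extend_right[OF swap_nat_left]
lemmas Assoc_nat_right_ext = extend_right[OF Assoc_nat_right]
lemmas swap_BoxO_right_ext = extend_right3[OF swap_BoxO_right]
lemmas swap_BoxO_left_ext = extend_right[OF swap_BoxO_left]
lemmas LUnit_swap_ext = extend_right[OF LUnit_swap]
lemmas RUnit_BoxO_ext = extend_right[OF RUnit_BoxO]
lemmas swap_Symm_ext = extend_right[OF swap_Symm]
lemmas Symm_swap_ext = extend_right[OF Symm_swap]

end


section \<open>Replacing a variable by the unit\<close>

text \<open>The letter is replaced by the unit instead of being dropped, so that the shape of the
  word survives and each formal arrow goes to one of the same kind.\<close>

fun erase_word :: "'v \<Rightarrow> 'v word \<Rightarrow> 'v word" where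
  "erase_word x (Var y) = (if y = x then E else Var y)"
| "erase_word x E = E"
| "erase_word x (Box a b) = Box (erase_word x a) (erase_word x b)"

fun erase_component :: "'v \<Rightarrow> 'v component \<Rightarrow> 'v component" where
  "erase_component x (Alpha a b c) = Alpha (erase_word x a) (erase_word x b) (erase_word x c)"
| "erase_component x (Lambda a) = Lambda (erase_word x a)"
| "erase_component x (Rho a) = Rho (erase_word x a)"
| "erase_component x (Tau a b) = Tau (erase_word x a) (erase_word x b)"

fun erase_arrow :: "'v \<Rightarrow> 'v arrow \<Rightarrow> 'v arrow" where
  "erase_arrow x (Fwd c) = Fwd (erase_component x c)"
| "erase_arrow x (Inv c) = Inv (erase_component x c)"
| "erase_arrow x (BoxId a w) = BoxId (erase_arrow x a) (erase_word x w)"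
| "erase_arrow x (IdBox w a) = IdBox (erase_word x w) (erase_arrow x a)"

lemma word_vars_erase_word [simp]: "word_vars (erase_word x w) = removeAll x (word_vars w)"
  by (induction w) auto

lemma erase_word_ident [simp]: "x \<notin> set (word_vars w) \<Longrightarrow> erase_word x w = w"
  by (induction w) auto

lemma src_erase_arrow [simp]: "src (erase_arrow x a) = erase_word x (src a)"
  and tgt_erase_arrow [simp]: "tgt (erase_arrow x a) = erase_word x (tgt a)"
proof -
  have "comp_src (erase_component x c) = erase_word x (comp_src c)"
    "comp_tgt (erase_component x c) = erase_word x (comp_tgt c)" for c
    by (cases c; simp)+
  then show "src (erase_arrow x a) = erase_word x (src a)"
    "tgt (erase_arrow x a) = erase_word x (tgt a)"
    by (induction a) auto
qed

lemma word_vars_comp_tgt [simp]: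
  "set (word_vars (comp_tgt c)) = set (word_vars (comp_src c))"
  "distinct (word_vars (comp_tgt c)) \<longleftrightarrow> distinct (word_vars (comp_src c))"
  by (cases c; auto)+

lemma word_vars_tgt [simp]:
  "set (word_vars (tgt a)) = set (word_vars (src a))"
  "distinct (word_vars (tgt a)) \<longleftrightarrow> distinct (word_vars (src a))"
proof -
  show *: "set (word_vars (tgt a)) = set (word_vars (src a))" for a :: "'a arrow"
    by (induction a) auto
  show "distinct (word_vars (tgt a)) \<longleftrightarrow> distinct (word_vars (src a))"
    by (induction a) (auto simp: *)
qed

lemma erase_arrow_ident [simp]:
  assumes "x \<notin> set (word_vars (src a))"
  shows "erase_arrow x a = a"
proof -
  have "erase_component x c = c" if "x \<notin> set (word_vars (comp_src c))" for c
    using that by (cases c) auto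
  then show ?thesis
    using assms by (induction a) auto
qed


section \<open>Canonical isomorphisms\<close>

locale symmetric_monoidal_valuation = symmetric_monoidal_category C
  for C :: "('o, 'a, 'm) symmetric_monoidal_category_scheme" (structure) +
  fixes s :: "'v \<Rightarrow> 'o"
  assumes valuation_in_Ob [simp]: "s x \<in> Ob C"
begin

abbreviation ev :: "'v word \<Rightarrow> 'o" where
  "ev \<equiv> eval_word C s"

lemma eval_word_in_Ob [simp]: "ev w \<in> Ob C"
  by (induction w) auto

lemma eval_component_typing [simp]:
  "iso_arrow C (eval_component C s c)"
  "eval_component C s c \<in> Ar C"
  "Dom C (eval_component C s c) = ev (comp_src c)"
  "Cod C (eval_component C s c) = ev (comp_tgt c)"
  by (cases c; simp)+

lemma eval_arrow_typing [simp]: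
  "iso_arrow C (eval_arrow C s a)"
  "eval_arrow C s a \<in> Ar C"
  "Dom C (eval_arrow C s a) = ev (src a)"
  "Cod C (eval_arrow C s a) = ev (tgt a)"
  by (induction a) auto

section \<open>Words without variables\<close>

text \<open>Meant for words without variables; the value at a variable is a dummy.\<close>

fun collapse :: "'v word \<Rightarrow> 'a" where
  "collapse (Var y) = Id C (s y)"
| "collapse E = Id C \<e>"
| "collapse (Box a b) = LUnit C \<e> \<cdot> (collapse a \<boxtimes> collapse b)"

lemma collapse_typing [simp]:
  assumes "word_vars w = []"
  shows "iso_arrow C (collapse w)" "collapse w \<in> Ar C" "Dom C (collapse w) = ev w"
    "Cod C (collapse w) = \<e>"
  using assms by (induction w) auto

text \<open>Naturality carries the component to the unit object, where the triangle,
  \<open>LUnit_UnitO\<close> and \<open>LUnit_Symm\<close> finish the proof.\<close>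

lemma collapse_component:
  assumes "word_vars (comp_src c) = []"
  shows "collapse (comp_tgt c) \<cdot> eval_component C s c = collapse (comp_src c)"
proof (cases c)
  case (Alpha x y z)
  then have [simp]: "word_vars x = []" "word_vars y = []" "word_vars z = []"
    using assms by auto
  \<comment> \<open>The unit isomorphisms are separated from the collapses, which leaves the
    triangle at \<open>\<e>, \<e>\<close>.\<close>
  have "collapse x \<boxtimes> (LUnit C \<e> \<cdot> (collapse y \<boxtimes> collapse z))
      = (Id C \<e> \<boxtimes> LUnit C \<e>) \<cdot> (collapse x \<boxtimes> (collapse y \<boxtimes> collapse z))"
    by (simp add: interchange)
  moreover have "(LUnit C \<e> \<cdot> (collapse x \<boxtimes> collapse y)) \<boxtimes> collapse z
      = (LUnit C \<e> \<boxtimes> Id C \<e>) \<cdot> ((collapse x \<boxtimes> collapse y) \<boxtimes> collapse z)"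
    by (simp add: interchange)
  moreover have "(collapse x \<boxtimes> (collapse y \<boxtimes> collapse z)) \<cdot> Assoc C (ev x) (ev y) (ev z)
      = Assoc C \<e> \<e> \<e> \<cdot> ((collapse x \<boxtimes> collapse y) \<boxtimes> collapse z)"
    by (simp add: Assoc_nat)
  ultimately show ?thesis
    using Alpha by (simp add: triangle_ext flip: LUnit_UnitO)
next
  case (Lambda x)
  then show ?thesis
    using assms by (simp add: LUnit_nat)
next
  case (Rho x)
  then show ?thesis
    using assms by (simp add: RUnit_nat LUnit_UnitO)
next
  case (Tau x y)
  then have [simp]: "word_vars x = []" "word_vars y = []"
    using assms by auto
  have "(collapse y \<boxtimes> collapse x) \<cdot> Symm C (ev x) (ev y)
      = Symm C \<e> \<e> \<cdot> (collapse x \<boxtimes> collapse y)"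
    by (simp add: Symm_nat)
  then show ?thesis
    using Tau extend_right[OF LUnit_Symm, of \<e> "collapse x \<boxtimes> collapse y"]
    by (simp add: LUnit_UnitO)
qed

lemma collapse_arrow:
  assumes "word_vars (src a) = []"
  shows "collapse (tgt a) \<cdot> eval_arrow C s a = collapse (src a)"
proof -
  have empty_tgt: "word_vars (tgt a) = [] \<longleftrightarrow> word_vars (src a) = []" for a :: "'v arrow"
    using word_vars_tgt(1)[of a] by (metis set_empty)
  have empty_comp: "word_vars (comp_tgt c) = [] \<longleftrightarrow> word_vars (comp_src c) = []"
    for c :: "'v component"
    using word_vars_comp_tgt(1)[of c] by (metis set_empty)
  show ?thesis
    using assms
  proof (induction a)
    case (Fwd c)
    then show ?case by (simp add: collapse_component)
  next
    case (Inv c)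
    then have "word_vars (comp_src c) = []"
      by (simp add: empty_comp)
    \<comment> \<open>Reading \<open>collapse_component\<close> from right to left produces the
      factor that cancels the inverse.\<close>
    then show ?case
      using empty_comp[of c] by (simp flip: collapse_component)
  qed (simp_all add: empty_tgt interchange)
qed

section \<open>Moving one variable to the front\<close>

text \<open>Moves the variable \<open>x\<close> to the front, leaving a unit in its place. It is meant for linear
  words containing \<open>x\<close>.\<close>

fun to_front :: "'v \<Rightarrow> 'v word \<Rightarrow> 'a" where
  "to_front x (Var y) = inv_arrow C (RUnit C (s y))"
| "to_front x E = Id C \<e>"
| "to_front x (Box a b) =
    (if x \<in> set (word_vars a)
     then Assoc C (s x) (ev (erase_word x a)) (ev b) \<cdot> (to_front x a \<boxtimes> Id C (ev b))
     else swap (ev a) (s x) (ev (erase_word x b)) \<cdot> (Id C (ev a) \<boxtimes> to_front x b))"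

lemma to_front_typing [simp]:
  assumes "x \<in> set (word_vars w)" "distinct (word_vars w)"
  shows "iso_arrow C (to_front x w)" "to_front x w \<in> Ar C" "Dom C (to_front x w) = ev w"
    "Cod C (to_front x w) = s x \<box> ev (erase_word x w)"
proof -
  have "iso_arrow C (to_front x w) \<and> to_front x w \<in> Ar C \<and> Dom C (to_front x w) = ev w \<and>
      Cod C (to_front x w) = s x \<box> ev (erase_word x w)"
    using assms
  proof (induction w)
    case (Box a b)
    then show ?case
      by (cases "x \<in> set (word_vars a)") (auto simp: disjoint_iff)
  qed auto
  then show "iso_arrow C (to_front x w)" "to_front x w \<in> Ar C" "Dom C (to_front x w) = ev w"
    "Cod C (to_front x w) = s x \<box> ev (erase_word x w)"
    by auto
qed

text \<open>Linearity puts \<open>x\<close> in exactly one factor, and each position has its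
  identity: the pentagon, \<open>swap_BoxO_right\<close> and \<open>swap_BoxO_left\<close> for the
  three factors of an associativity, \<open>LUnit_swap\<close> and \<open>RUnit_BoxO\<close> for the
  units, \<open>swap_Symm\<close> and \<open>Symm_swap\<close> for the symmetry.\<close>

lemma to_front_component:
  assumes "x \<in> set (word_vars (comp_src c))" "distinct (word_vars (comp_src c))"
  shows "to_front x (comp_tgt c) \<cdot> eval_component C s c
    = (Id C (s x) \<boxtimes> eval_component C s (erase_component x c)) \<cdot> to_front x (comp_src c)"
proof (cases c)
  case (Alpha u v w)
  then consider
      (u) "x \<in> set (word_vars u)" "x \<notin> set (word_vars v)" "x \<notin> set (word_vars w)"
    | (v) "x \<notin> set (word_vars u)" "x \<in> set (word_vars v)" "x \<notin> set (word_vars w)"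
    | (w) "x \<notin> set (word_vars u)" "x \<notin> set (word_vars v)" "x \<in> set (word_vars w)"
    using assms by auto
  moreover have "distinct (word_vars u)" "distinct (word_vars v)" "distinct (word_vars w)"
    using assms Alpha by auto
  ultimately show ?thesis
  proof cases
    case u
    with Alpha \<open>distinct (word_vars u)\<close> show ?thesis
      by (simp add: whisker_right pentagon_ext Assoc_nat)
  next
    case v
    with Alpha \<open>distinct (word_vars v)\<close> show ?thesis
      by (simp add: whisker_left whisker_right swap_BoxO_right_ext Assoc_nat)
  next
    case w
    with Alpha \<open>distinct (word_vars w)\<close> show ?thesis
      by (simp add: whisker_left swap_BoxO_left_ext Assoc_nat_right)
  qed
next
  case (Lambda u)
  then show ?thesis
    using assms by (simp add: LUnit_swap_ext LUnit_nat)
next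
  case (Rho u)
  then show ?thesis
    using assms by (simp add: RUnit_BoxO_ext RUnit_nat)
next
  case (Tau u v)
  then consider
      (u) "x \<in> set (word_vars u)" "x \<notin> set (word_vars v)"
    | (v) "x \<notin> set (word_vars u)" "x \<in> set (word_vars v)"
    using assms by auto
  moreover have [simp]: "distinct (word_vars u)" "distinct (word_vars v)"
    using assms Tau by auto
  ultimately show ?thesis
  proof cases
    case u
    then have "(Id C (ev v) \<boxtimes> to_front x u) \<cdot> Symm C (ev u) (ev v)
        = Symm C (s x \<box> ev (erase_word x u)) (ev v) \<cdot> (to_front x u \<boxtimes> Id C (ev v))"
      by (simp add: Symm_nat)
    with Tau u show ?thesis
      by (simp add: swap_Symm_ext)
  next
    case v
    with Tau show ?thesis
      by (simp add: Symm_swap_ext Symm_nat)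
  qed
qed

text \<open>If \<open>x\<close> lies in the factor on which a whiskered arrow acts, the induction
  hypothesis is whiskered. Otherwise the arrow and the move act on different factors and commute by
  interchange.\<close>

lemma to_front_arrow:
  assumes "x \<in> set (word_vars (src a))" "distinct (word_vars (src a))"
  shows "to_front x (tgt a) \<cdot> eval_arrow C s a
    = (Id C (s x) \<boxtimes> eval_arrow C s (erase_arrow x a)) \<cdot> to_front x (src a)"
  using assms
proof (induction a)
  case (Fwd c)
  then show ?case by (simp add: to_front_component)
next
  case (Inv c)
  then have [simp]: "x \<in> set (word_vars (comp_src c))" "distinct (word_vars (comp_src c))"
    by simp_all
  have [simp]: "ev (comp_src (erase_component x c)) = ev (erase_word x (comp_src c))"
    "ev (comp_tgt (erase_component x c)) = ev (erase_word x (comp_tgt c))"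
    using src_erase_arrow[of x "Fwd c"] tgt_erase_arrow[of x "Fwd c"] by simp_all
  \<comment> \<open>The square for \<open>c\<close> is inverted; the identity on \<open>s x\<close>
    is its own inverse.\<close>
  show ?case
    using inv_arrow_square[OF to_front_component[of x c]] by (simp add: inv_arrow_BoxA)
next
  case (BoxId a w)
  show ?case
  proof (cases "x \<in> set (word_vars (src a))")
    case True
    with BoxId.prems have [simp]: "distinct (word_vars (src a))" "x \<notin> set (word_vars w)"
      by auto
    have "(to_front x (tgt a) \<boxtimes> Id C (ev w)) \<cdot> (eval_arrow C s a \<boxtimes> Id C (ev w))
        = ((Id C (s x) \<boxtimes> eval_arrow C s (erase_arrow x a)) \<boxtimes> Id C (ev w))
          \<cdot> (to_front x (src a) \<boxtimes> Id C (ev w))"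
      using BoxId.IH True by (simp flip: whisker_right)
    with True show ?thesis
      by (simp add: Assoc_nat_ext)
  next
    case False
    with BoxId.prems have [simp]: "distinct (word_vars w)" "x \<in> set (word_vars w)"
      by auto
    have "(Id C (ev (tgt a)) \<boxtimes> to_front x w) \<cdot> (eval_arrow C s a \<boxtimes> Id C (ev w))
        = (eval_arrow C s a \<boxtimes> Id C (s x \<box> ev (erase_word x w)))
          \<cdot> (Id C (ev (src a)) \<boxtimes> to_front x w)"
      by (simp add: interchange)
    with False show ?thesis
      by (simp add: swap_nat_left_ext)
  qed
next
  case (IdBox w a)
  show ?case
  proof (cases "x \<in> set (word_vars w)")
    case True
    with IdBox.prems have [simp]: "distinct (word_vars w)" "x \<notin> set (word_vars (src a))"
      by auto
    have "(to_front x w \<boxtimes> Id C (ev (tgt a))) \<cdot> (Id C (ev w) \<boxtimes> eval_arrow C s a)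
        = (Id C (s x \<box> ev (erase_word x w)) \<boxtimes> eval_arrow C s a)
          \<cdot> (to_front x w \<boxtimes> Id C (ev (src a)))"
      using True by (simp add: interchange)
    with True show ?thesis
      by (simp add: Assoc_nat_right_ext)
  next
    case False
    with IdBox.prems have [simp]: "distinct (word_vars (src a))" "x \<in> set (word_vars (src a))"
      by auto
    have "(Id C (ev w) \<boxtimes> to_front x (tgt a)) \<cdot> (Id C (ev w) \<boxtimes> eval_arrow C s a)
        = (Id C (ev w) \<boxtimes> (Id C (s x) \<boxtimes> eval_arrow C s (erase_arrow x a)))
          \<cdot> (Id C (ev w) \<boxtimes> to_front x (src a))"
      using IdBox.IH by (simp flip: whisker_left)
    with False show ?thesis
      by (simp add: swap_nat_ext)
  qed
qed

section \<open>Canonical isomorphisms for a fixed order of the variables\<close>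

fun canonical :: "'v list \<Rightarrow> 'v word \<Rightarrow> 'a" where
  "canonical [] w = collapse w"
| "canonical (x # t) w = (Id C (s x) \<boxtimes> canonical t (erase_word x w)) \<cdot> to_front x w"

text \<open>The codomain, a right-nested product ending in \<open>\<e>\<close>, depends on
  \<open>t\<close> alone, so words with the same variables are sent to one object.\<close>

lemma canonical_typing [simp]:
  assumes "distinct t" "distinct (word_vars w)" "set (word_vars w) = set t"
  shows "iso_arrow C (canonical t w)" "canonical t w \<in> Ar C" "Dom C (canonical t w) = ev w"
    "Cod C (canonical t w) = foldr (\<lambda>x y. s x \<box> y) t \<e>"
proof -
  have "iso_arrow C (canonical t w) \<and> canonical t w \<in> Ar C \<and> Dom C (canonical t w) = ev w \<and>
    Cod C (canonical t w) = foldr (\<lambda>x y. s x \<box> y) t \<e>"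
    using assms
  proof (induction t arbitrary: w)
    case (Cons x t)
    then show ?case
      using Cons.IH[of "erase_word x w"] by (simp add: distinct_removeAll)
  qed simp
  then show "iso_arrow C (canonical t w)" "canonical t w \<in> Ar C" "Dom C (canonical t w) = ev w"
    "Cod C (canonical t w) = foldr (\<lambda>x y. s x \<box> y) t \<e>"
    by auto
qed

text \<open>The induction on \<open>t\<close> covers all arrows at once, because
  \<open>to_front_arrow\<close> passes from \<open>a\<close> to the erased arrow, to which the
  hypothesis is applied. The base case is \<open>collapse_arrow\<close>.\<close>

lemma canonical_arrow:
  assumes "distinct t" "distinct (word_vars (src a))" "set (word_vars (src a)) = set t"
  shows "canonical t (tgt a) \<cdot> eval_arrow C s a = canonical t (src a)"
  using assms
proof (induction t arbitrary: a)
  case Nil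
  then show ?case by (simp add: collapse_arrow)
next
  case (Cons x t)
  then have [simp]: "distinct t" "distinct (word_vars (src a))" "set (word_vars (src a)) = insert x (set t)"
    "x \<notin> set t"
    by auto
  have "canonical (x # t) (tgt a) \<cdot> eval_arrow C s a
      = (Id C (s x) \<boxtimes> canonical t (erase_word x (tgt a)))
        \<cdot> (Id C (s x) \<boxtimes> eval_arrow C s (erase_arrow x a)) \<cdot> to_front x (src a)"
    by (simp add: to_front_arrow distinct_removeAll)
  also have "\<dots> = (Id C (s x) \<boxtimes> (canonical t (erase_word x (tgt a)) \<cdot> eval_arrow C s (erase_arrow x a)))
      \<cdot> to_front x (src a)"
    by (simp add: whisker_left distinct_removeAll)
  also have "\<dots> = canonical (x # t) (src a)"
    using Cons.IH[of "erase_arrow x a"] by (simp add: distinct_removeAll)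
  finally show ?case .
qed

text \<open>Typing and linearity travel along the path in the same induction as the absorption law,
  since rebracketing and \<open>canonical_arrow\<close> require them.\<close>

lemma canonical_path:
  assumes "diagram G" "set p \<subseteq> arcs G" "pre_digraph.cas G u p v"
    "distinct t" "distinct (word_vars u)" "set (word_vars u) = set t"
  shows "eval_path C s u p \<in> Ar C" "Dom C (eval_path C s u p) = ev u"
    "Cod C (eval_path C s u p) = ev v" "distinct (word_vars v)" "set (word_vars v) = set t"
    "canonical t v \<cdot> eval_path C s u p = canonical t u"
proof -
  have "eval_path C s u p \<in> Ar C \<and> Dom C (eval_path C s u p) = ev u \<and>
      Cod C (eval_path C s u p) = ev v \<and> distinct (word_vars v) \<and> set (word_vars v) = set t \<and>
      canonical t v \<cdot> eval_path C s u p = canonical t u"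
    using assms(2-)
  proof (induction p arbitrary: u)
    case Nil
    then show ?case by (simp add: pre_digraph.cas.simps)
  next
    case (Cons a p)
    then have [simp]: "src a = u" and cas: "pre_digraph.cas G (tgt a) p v"
      using assms(1) by (auto simp: pre_digraph.cas.simps diagram_def)
    show ?case
      \<comment> \<open>\<open>extend_right\<close> regroups the composite: the hypothesis absorbs
        the tail of the path, then \<open>canonical_arrow\<close> absorbs its first edge.\<close>
      using Cons.IH[OF _ cas] Cons.prems canonical_arrow[of t a]
        extend_right[of "canonical t v" "eval_path C s (tgt a) p" _ "eval_arrow C s a"]
      by simp
  qed
  then show "eval_path C s u p \<in> Ar C" "Dom C (eval_path C s u p) = ev u"
    "Cod C (eval_path C s u p) = ev v" "distinct (word_vars v)" "set (word_vars v) = set t"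
    "canonical t v \<cdot> eval_path C s u p = canonical t u"
    by auto
qed

end

section \<open>Paths with common ends\<close>

theorem mainTheorem1:
  fixes C :: "('o, 'a, 'm) symmetric_monoidal_category_scheme"
    and G :: "('v word, 'v arrow) pre_digraph"
    and s :: "'v \<Rightarrow> 'o"
    and u v :: "'v word"
    and p q :: "'v arrow list"
  assumes "symmetric_monoidal_category C"
    and "linear_diagram G"
    and "\<And>x. s x \<in> Ob C"
    and "pre_digraph.awalk G u p v"
    and "pre_digraph.awalk G u q v"
  shows "eval_path C s u p = eval_path C s u q"
proof -
  interpret symmetric_monoidal_valuation C s
    using assms(1,3)
    by (simp add: symmetric_monoidal_valuation_def symmetric_monoidal_valuation_axioms_def)
  have G: "diagram G" and u: "distinct (word_vars u)"
    using assms(2,4) by (auto simp: linear_diagram_def pre_digraph.awalk_def)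
  have p: "set p \<subseteq> arcs G" "pre_digraph.cas G u p v"
    and q: "set q \<subseteq> arcs G" "pre_digraph.cas G u q v"
    using assms(4,5) by (auto simp: pre_digraph.awalk_def)
  \<comment> \<open>The order of the variables is that of \<open>u\<close> for both paths, so both
    are compared through the same isomorphism at \<open>v\<close>.\<close>
  note P = canonical_path[OF G p u u refl] and Q = canonical_path[OF G q u u refl]
  show ?thesis
    by (rule iso_arrow_left_cancel[of "canonical (word_vars u) v"]) (use u P Q in simp_all)
qed

end
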